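(* Let $(Y,X,V)$ be a random vector. (i) Suppose $E[Y\mid X,V]=p(X)'q_0(V)$ for a known $J$-vector of functions $p(X)$ and an unknown $J$-vector of functional coefficients $q_0(V)$. If $E[\{p(X)'q_0(V)\}^2]<\infty$ and $E[p(X)p(X)'\mid V]$ is nonsingular with probability one, then $q_0(V)$ is identified. (ii) Suppose $E[Y\mid X,V]=p_0(X)'q(V)$ for a known $K$-vector of functions $q(V)$ and an unknown $K$-vector of functional coefficients $p_0(X)$. If $E[\{p_0(X)'q(V)\}^2]<\infty$ and $E[q(V)q(V)'\mid X]$ is nonsingular with probability one, then $p_0(X)$ is identified.
   Context: $J$ and $K$ are finite. Identification of $q_0(V)$ means uniqueness with probability one given the conditional expectation function: any measurable $\bar q$ with $p(X)'\bar q(V)=p(X)'q_0(V)$ almost surely satisfies $\bar q(V)=q_0(V)$ almost surely. Likewise $p_0(X)$ is identified if any measurable $\bar p$ with $\bar p(X)'q(V)=p_0(X)'q(V)$ almost surely satisfies $\bar p(X)=p_0(X)$ almost surely. The conditional second moment matrices are assumed to exist and be finite. *)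

theory Defs
  imports "HOL-Probability.Probability"
begin

text \<open>The sub-sigma-algebra of events determined by a random vector \<open>Z\<close>.\<close>

definition sigma_of :: "'w measure \<Rightarrow> ('w \<Rightarrow> 'z::topological_space) \<Rightarrow> 'w measure" where
  "sigma_of M Z = vimage_algebra (space M) Z borel"

text \<open>\<open>real_cond_exp\<close> is total. The following predicate says that it denotes a genuine, almost
  surely finite conditional expectation, namely that the conditional expectation of \<open>\<bar>f\<bar>\<close> is finite
  almost surely. This is implied by, but weaker than, integrability of \<open>f\<close>.\<close>

definition cond_exp_finite :: "'w measure \<Rightarrow> 'w measure \<Rightarrow> ('w \<Rightarrow> real) \<Rightarrow> bool" where
  "cond_exp_finite M F f \<longleftrightarrow>
     f \<in> borel_measurable M \<and> (AE w in M. nn_cond_exp M F (\<lambda>w. ennreal \<bar>f w\<bar>) w < \<infinity>)"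

definition cond_second_moment ::
    "'w measure \<Rightarrow> 'w measure \<Rightarrow> ('w \<Rightarrow> real ^ 'n) \<Rightarrow> 'w \<Rightarrow> real ^ 'n ^ 'n" where
  "cond_second_moment M F r w = (\<chi> i j. real_cond_exp M F (\<lambda>w. r w $ i * r w $ j) w)"

definition cond_second_moment_finite ::
    "'w measure \<Rightarrow> 'w measure \<Rightarrow> ('w \<Rightarrow> real ^ 'n) \<Rightarrow> bool" where
  "cond_second_moment_finite M F r \<longleftrightarrow> (\<forall>i j. cond_exp_finite M F (\<lambda>w. r w $ i * r w $ j))"

text \<open>Identification of the coefficient function \<open>b\<close> of \<open>Z\<close> from the conditional expectation
  function \<open>r \<bullet> b(Z)\<close>, where \<open>r\<close> is the random vector that multiplies the coefficients.\<close>

definition identified ::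
    "'w measure \<Rightarrow> ('w \<Rightarrow> real ^ 'n) \<Rightarrow> ('w \<Rightarrow> 'z::topological_space) \<Rightarrow> ('z \<Rightarrow> real ^ 'n) \<Rightarrow> bool" where
  "identified M r Z b \<longleftrightarrow>
     (\<forall>b'. b' \<in> borel_measurable borel \<longrightarrow>
        (AE w in M. r w \<bullet> b' (Z w) = r w \<bullet> b (Z w)) \<longrightarrow>
        (AE w in M. b' (Z w) = b (Z w)))"

end

theory Submission
  imports Defs
begin

text \<open>The difference \<open>d\<close> of two coefficient functions that fit equally well satisfies \<open>r \<bullet> d = 0\<close>
  almost surely. Multiplying by \<open>r\<close> and conditioning on the argument of \<open>d\<close> pulls \<open>d\<close> out of the
  conditional expectation and gives \<open>E[r r'] d = 0\<close>, so \<open>d = 0\<close> by nonsingularity. Since the entries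
  of \<open>r r'\<close> and \<open>d\<close> need not be integrable, the pull-out is performed on events of the conditioning
  sigma-algebra on which \<open>d\<close> and the conditional absolute moments are bounded.\<close>

text \<open>Because \<open>c\<close> is measurable with respect to \<open>F\<close>, the integral of
  \<open>\<bar>c\<bar> * \<bar>g\<bar>\<close> does not change when \<open>\<bar>g\<bar>\<close> is
  replaced by its conditional expectation. The new integrand is at most the constant
  \<open>C * D\<close>, which has finite integral over a finite measure.\<close>

lemma (in finite_measure_subalgebra) integrable_bounded_mult:
  fixes c g :: "'a \<Rightarrow> real" and C D :: real
  assumes c [measurable]: "c \<in> borel_measurable F" and g [measurable]: "g \<in> borel_measurable M"
    and bound: "\<And>w. \<bar>c w\<bar> \<le> C"
    and moment: "\<And>w. c w \<noteq> 0 \<Longrightarrow> nn_cond_exp M F (\<lambda>w. ennreal \<bar>g w\<bar>) w \<le> ennreal D"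
  shows "integrable M (\<lambda>w. c w * g w)"
proof (rule integrableI_bounded)
  have [measurable]: "c \<in> borel_measurable M"
    using measurable_from_subalg[OF subalg c] .
  show "(\<lambda>w. c w * g w) \<in> borel_measurable M" by measurable
  have "(\<integral>\<^sup>+w. ennreal (norm (c w * g w)) \<partial>M) = (\<integral>\<^sup>+w. ennreal \<bar>c w\<bar> * ennreal \<bar>g w\<bar> \<partial>M)"
    by (simp add: abs_mult ennreal_mult)
  also have "\<dots> = (\<integral>\<^sup>+w. ennreal \<bar>c w\<bar> * nn_cond_exp M F (\<lambda>w. ennreal \<bar>g w\<bar>) w \<partial>M)"
    by (rule nn_cond_exp_intg[symmetric]) auto
  also have "\<dots> \<le> (\<integral>\<^sup>+w. ennreal C * ennreal D \<partial>M)"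
  proof (rule nn_integral_mono)
    fix w
    show "ennreal \<bar>c w\<bar> * nn_cond_exp M F (\<lambda>w. ennreal \<bar>g w\<bar>) w \<le> ennreal C * ennreal D"
      \<comment> \<open>Where \<open>c\<close> vanishes the conditional moment may be infinite, but
        \<open>0 * \<infinity> = 0\<close> in \<open>ennreal\<close>.\<close>
      by (cases "c w = 0") (auto intro!: mult_mono ennreal_leI bound moment)
  qed
  also have "\<dots> < \<infinity>"
    by (simp add: ennreal_mult_less_top emeasure_eq_measure)
  finally show "(\<integral>\<^sup>+w. ennreal (norm (c w * g w)) \<partial>M) < \<infinity>" .
qed

lemma (in finite_measure_subalgebra) cond_exp_linear_relation:
  fixes d g :: "'j::finite \<Rightarrow> 'a \<Rightarrow> real"
  assumes d [measurable]: "\<And>j. d j \<in> borel_measurable F"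
    and g: "\<And>j. cond_exp_finite M F (g j)"
    and zero: "AE w in M. (\<Sum>j\<in>UNIV. d j w * g j w) = 0"
  shows "AE w in M. (\<Sum>j\<in>UNIV. d j w * real_cond_exp M F (g j) w) = 0"
proof -
  have [measurable]: "g j \<in> borel_measurable M" for j
    using g by (simp add: cond_exp_finite_def)
  have [measurable]: "d j \<in> borel_measurable M" for j
    using measurable_from_subalg[OF subalg d] .
  define N where "N j = nn_cond_exp M F (\<lambda>w. ennreal \<bar>g j w\<bar>)" for j
  have [measurable]: "N j \<in> borel_measurable F" for j
    by (simp add: N_def)
  \<comment> \<open>Both bounds concern functions measurable with respect to \<open>F\<close>, so
    the indicator of \<open>A n\<close> can be absorbed into the coefficients that are pulled
    out.\<close>
  define A where "A n = {w \<in> space F. \<forall>j. N j w \<le> ennreal (real n) \<and> \<bar>d j w\<bar> \<le> real n}" for n :: nat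
  have [measurable]: "A n \<in> sets F" for n
    unfolding A_def by measurable
  have local: "AE w in M. w \<in> A n \<longrightarrow> (\<Sum>j\<in>UNIV. d j w * real_cond_exp M F (g j) w) = 0" for n
  proof -
    define c where "c j w = indicator (A n) w * d j w" for j w
    have c_meas [measurable]: "c j \<in> borel_measurable F" for j
      unfolding c_def by measurable
    have [measurable]: "c j \<in> borel_measurable M" for j
      using measurable_from_subalg[OF subalg c_meas] .
    have int: "integrable M (\<lambda>w. c j w * g j w)" for j
    proof (rule integrable_bounded_mult[where C = "real n" and D = "real n"])
      show "\<bar>c j w\<bar> \<le> real n" for w
        by (auto simp: c_def A_def indicator_def)
      show "nn_cond_exp M F (\<lambda>w. ennreal \<bar>g j w\<bar>) w \<le> ennreal (real n)" if "c j w \<noteq> 0" for w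
        using that by (auto simp: c_def A_def N_def indicator_def split: if_splits)
    qed measurable
    \<comment> \<open>Pulling out \<open>c j\<close> requires the product \<open>c j * g j\<close>
      to be integrable, which the truncation to \<open>A n\<close> ensures.\<close>
    have "AE w in M. real_cond_exp M F (\<lambda>w. c j w * g j w) w = c j w * real_cond_exp M F (g j) w" for j
      by (rule real_cond_exp_mult) (auto intro: int)
    then have pull: "AE w in M. \<forall>j. real_cond_exp M F (\<lambda>w. c j w * g j w) w
        = c j w * real_cond_exp M F (g j) w"
      by (simp add: AE_all_countable)
    have sum: "AE w in M. real_cond_exp M F (\<lambda>w. \<Sum>j\<in>UNIV. c j w * g j w) w
        = (\<Sum>j\<in>UNIV. real_cond_exp M F (\<lambda>w. c j w * g j w) w)"
      by (rule real_cond_exp_sum) (rule int)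
    \<comment> \<open>All coefficients carry the same indicator, which factors out of the sum and
      preserves the relation \<open>zero\<close>.\<close>
    have "AE w in M. (\<Sum>j\<in>UNIV. c j w * g j w) = 0"
      using zero by eventually_elim (simp add: c_def mult.assoc flip: sum_distrib_left)
    then have "AE w in M. real_cond_exp M F (\<lambda>w. \<Sum>j\<in>UNIV. c j w * g j w) w
        = real_cond_exp M F (\<lambda>w. 0) w"
      by (rule real_cond_exp_cong) auto
    moreover have "AE w in M. real_cond_exp M F (\<lambda>w. 0) w = 0"
      by (rule real_cond_exp_F_meas) auto
    ultimately show ?thesis
      using pull sum by eventually_elim (auto simp: c_def)
  qed
  \<comment> \<open>It remains to see that the countably many events \<open>A n\<close> cover almost
    every point; \<open>cond_exp_finite\<close> supplies the finiteness for this.\<close>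
  have "AE w in M. \<forall>j. N j w < \<infinity>"
    using g by (simp add: AE_all_countable cond_exp_finite_def N_def)
  then have "AE w in M. \<exists>n. w \<in> A n"
    using AE_space
  proof eventually_elim
    case (elim w)
    \<comment> \<open>The sum over the finite index type dominates each of its nonnegative terms, so
      a single \<open>n\<close> bounds all moments and coefficients at \<open>w\<close>.\<close>
    define m where "m = (\<Sum>j\<in>UNIV. enn2real (N j w) + \<bar>d j w\<bar>)"
    obtain n where n: "m \<le> real n"
      using real_arch_simple by blast
    have "N j w \<le> ennreal (real n) \<and> \<bar>d j w\<bar> \<le> real n" for j
    proof -
      have "enn2real (N j w) + \<bar>d j w\<bar> \<le> m"
        unfolding m_def by (rule member_le_sum) auto
      then have "enn2real (N j w) \<le> real n" "\<bar>d j w\<bar> \<le> real n"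
        using n enn2real_nonneg[of "N j w"] by linarith+
      \<comment> \<open>Finiteness enters here: \<open>enn2real\<close> sends
        \<open>\<infinity>\<close> to 0.\<close>
      moreover have "N j w = ennreal (enn2real (N j w))"
        using elim by simp
      ultimately show ?thesis
        by (metis ennreal_leI)
    qed
    then show ?case
      using elim subalg by (auto simp: A_def subalgebra_def)
  qed
  moreover have "AE w in M. \<forall>n. w \<in> A n \<longrightarrow> (\<Sum>j\<in>UNIV. d j w * real_cond_exp M F (g j) w) = 0"
    unfolding AE_all_countable using local by blast
  ultimately show ?thesis
    by eventually_elim auto
qed

text \<open>Row \<open>i\<close> of the matrix equation is the preceding lemma with
  \<open>g j\<close> the product of components \<open>i\<close> and \<open>j\<close> of
  \<open>r\<close>; its premise is \<open>r \<bullet> d = 0\<close> multiplied by component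
  \<open>i\<close> of \<open>r\<close>. An invertible matrix has trivial kernel.\<close>

lemma (in finite_measure_subalgebra) orthogonal_imp_zero:
  fixes r d :: "'a \<Rightarrow> real ^ 'n"
  assumes d [measurable]: "d \<in> borel_measurable F"
    and fin: "cond_second_moment_finite M F r"
    and inv: "AE w in M. invertible (cond_second_moment M F r w)"
    and zero: "AE w in M. r w \<bullet> d w = 0"
  shows "AE w in M. d w = 0"
proof -
  have "AE w in M. (\<Sum>j\<in>UNIV. d w $ j * real_cond_exp M F (\<lambda>w. r w $ i * r w $ j) w) = 0" for i
  proof (rule cond_exp_linear_relation)
    show "(\<lambda>w. d w $ j) \<in> borel_measurable F" for j
      by (rule measurable_compose[OF d borel_measurable_continuous_onI]) (intro continuous_intros)
    show "cond_exp_finite M F (\<lambda>w. r w $ i * r w $ j)" for j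
      using fin by (simp add: cond_second_moment_finite_def)
    show "AE w in M. (\<Sum>j\<in>UNIV. d w $ j * (r w $ i * r w $ j)) = 0"
      using zero
    proof eventually_elim
      case (elim w)
      have "(\<Sum>j\<in>UNIV. d w $ j * (r w $ i * r w $ j)) = r w $ i * (r w \<bullet> d w)"
        by (simp add: inner_vec_def sum_distrib_left algebra_simps)
      then show ?case
        using elim by simp
    qed
  qed
  then have "AE w in M. \<forall>i. (\<Sum>j\<in>UNIV. d w $ j * real_cond_exp M F (\<lambda>w. r w $ i * r w $ j) w) = 0"
    by (simp add: AE_all_countable)
  with inv show ?thesis
  proof eventually_elim
    case (elim w)
    have "cond_second_moment M F r w *v d w = 0"
      using elim(2) by (simp add: vec_eq_iff matrix_vector_mult_def cond_second_moment_def mult.commute)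
    with elim(1) show ?case
      by (meson invertible_left_inverse matrix_left_invertible_ker)
  qed
qed

lemma subalgebra_sigma_of:
  assumes "Z \<in> borel_measurable M"
  shows "subalgebra M (sigma_of M Z)"
  using measurable_sets[OF assms]
  by (auto simp: subalgebra_def sigma_of_def sets_vimage_algebra2)

lemma measurable_sigma_of: "Z \<in> borel_measurable (sigma_of M Z)"
  unfolding sigma_of_def by (rule measurable_vimage_algebra1) auto

text \<open>A difference of two coefficient functions evaluated at \<open>Z\<close> is measurable
  with respect to \<open>sigma_of M Z\<close>, so it can serve as \<open>d\<close> when conditioning
  on \<open>Z\<close>.\<close>

lemma (in finite_measure) identified_if_invertible:
  fixes r :: "'a \<Rightarrow> real ^ 'n" and Z :: "'a \<Rightarrow> 'z::topological_space" and b :: "'z \<Rightarrow> real ^ 'n"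
  assumes Z: "Z \<in> borel_measurable M" and b: "b \<in> borel_measurable borel"
    and fin: "cond_second_moment_finite M (sigma_of M Z) r"
    and inv: "AE w in M. invertible (cond_second_moment M (sigma_of M Z) r w)"
  shows "identified M r Z b"
  unfolding identified_def
proof (intro allI impI)
  fix b' :: "'z \<Rightarrow> real ^ 'n"
  assume b': "b' \<in> borel_measurable borel" and eq: "AE w in M. r w \<bullet> b' (Z w) = r w \<bullet> b (Z w)"
  interpret finite_measure_subalgebra M "sigma_of M Z"
    by standard (rule subalgebra_sigma_of[OF Z])
  have "AE w in M. b' (Z w) - b (Z w) = 0"
  proof (rule orthogonal_imp_zero[OF _ fin inv])
    show "(\<lambda>w. b' (Z w) - b (Z w)) \<in> borel_measurable (sigma_of M Z)"
      using measurable_compose[OF measurable_sigma_of b'] measurable_compose[OF measurable_sigma_of b]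
      by measurable
    show "AE w in M. r w \<bullet> (b' (Z w) - b (Z w)) = 0"
      using eq by eventually_elim (simp add: inner_diff_right)
  qed
  then show "AE w in M. b' (Z w) = b (Z w)"
    by eventually_elim simp
qed

theorem theorem2:
  fixes M :: "'w measure"
    and Y :: "'w \<Rightarrow> real"
    and X :: "'w \<Rightarrow> 'x::euclidean_space"
    and V :: "'w \<Rightarrow> 'v::euclidean_space"
  assumes "prob_space M"
    and "Y \<in> borel_measurable M" and "X \<in> borel_measurable M" and "V \<in> borel_measurable M"
    and "cond_exp_finite M (sigma_of M (\<lambda>w. (X w, V w))) Y"
  shows
    "(\<forall>(p :: 'x \<Rightarrow> real ^ 'J) (q0 :: 'v \<Rightarrow> real ^ 'J).
        p \<in> borel_measurable borel \<longrightarrow> q0 \<in> borel_measurable borel \<longrightarrow>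
        (AE w in M. real_cond_exp M (sigma_of M (\<lambda>w. (X w, V w))) Y w = p (X w) \<bullet> q0 (V w)) \<longrightarrow>
        integrable M (\<lambda>w. (p (X w) \<bullet> q0 (V w))\<^sup>2) \<longrightarrow>
        cond_second_moment_finite M (sigma_of M V) (\<lambda>w. p (X w)) \<longrightarrow>
        (AE w in M. invertible (cond_second_moment M (sigma_of M V) (\<lambda>w. p (X w)) w)) \<longrightarrow>
        identified M (\<lambda>w. p (X w)) V q0)
     \<and>
     (\<forall>(p0 :: 'x \<Rightarrow> real ^ 'K) (q :: 'v \<Rightarrow> real ^ 'K).
        p0 \<in> borel_measurable borel \<longrightarrow> q \<in> borel_measurable borel \<longrightarrow>
        (AE w in M. real_cond_exp M (sigma_of M (\<lambda>w. (X w, V w))) Y w = p0 (X w) \<bullet> q (V w)) \<longrightarrow>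
        integrable M (\<lambda>w. (p0 (X w) \<bullet> q (V w))\<^sup>2) \<longrightarrow>
        cond_second_moment_finite M (sigma_of M X) (\<lambda>w. q (V w)) \<longrightarrow>
        (AE w in M. invertible (cond_second_moment M (sigma_of M X) (\<lambda>w. q (V w)) w)) \<longrightarrow>
        identified M (\<lambda>w. q (V w)) X p0)"
proof -
  interpret prob_space M by fact
  \<comment> \<open>The two halves exchange the roles of \<open>X\<close> and \<open>V\<close>:
    first \<open>r = p(X)\<close> with \<open>Z = V\<close>, then \<open>r = q(V)\<close> with
    \<open>Z = X\<close>.\<close>
  show ?thesis
    using assms(3,4) by (auto intro: identified_if_invertible)
qed

end
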